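(* Let $\mathcal M$ and $\mathcal N$ be $\mathfrak L$-structures. Then $\mathcal M$ and $\mathcal N$ are models of $T_{ML}$ if and only if $\mathcal M$ and $\mathcal N$ are complete metric lattices (with the order $x\le y\iff x+y=y$ and with $+$ as the join). Furthermore, in this case, the $\mathfrak L$-structure homomorphisms $\phi:\mathcal M\to\mathcal N$ are exactly the contractive maps such that $\phi(0)=0$, $\phi(1)=1$, and $\phi(x+y)=\phi(x)+\phi(y)$ for all $x,y\in\mathcal M$, and for such $\phi$ the image $\phi(\mathcal M)\subseteq\mathcal N$ is a model of $T_{ML}$.
   Context: We use continuous first-order logic of metric structures. The language $\mathfrak L$ has one sort (a complete metric space $(X,d)$ of diameter $1$), constants $0,1$, and a binary function symbol $+$ that is contractive when $X\times X$ carries the $\ell^1$-metric. Write $a\mathbin{\dot-}b=\max\{a-b,0\}$. $T_{ML}$ consists of the axioms (each sentence required to be $0$): $d(0,1)=1$; $\sup_x d(x+0,x)+d(x+1,1)$; $\sup_x d(x+x,x)$; $\sup_{x,y}d(x+y,y+x)$; $\sup_{x,y,z}d((x+y)+z,x+(y+z))$; $\sup_{x,y,z}(d(x+z,y+z)\mathbin{\dot-}d(x,y))$; $\sup_{x,y,z}\bigl([d(x,y)+d(z,0)]\mathbin{\dot-}[d(x+y,0)+d(x+z,x)+d(y+z,y)]\bigr)$. Homomorphisms of $\mathfrak L$-structures are maps that preserve the constants and function symbols and do not increase the metric; contractive means $1$-Lipschitz. A metric lattice is a tuple $(L,<,+,\cdot,0,1,d)$ where $(L,<)$ is a partially ordered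 set with minimal element $0$ and maximal element $1$; $+$ (join) and $\cdot$ (meet) are commutative, associative, idempotent; $x\le y$ iff $x+y=y$ iff $xy=x$; and $d$ is a metric on $L$ with $d(1,0)=1$, $d(x+z,y+z)\le d(x,y)$, and $d(x,y)\le d(x+y,0)-d(xy,0)$ for all $x,y,z\in L$. It is complete if $(L,d)$ is a complete metric space. *)

theory Defs
  imports "HOL-Analysis.Analysis"
begin

section \<open>Contractive maps and the \<open>l\<^sup>1\<close>-metric\<close>

definition contractive :: "'a metric \<Rightarrow> 'b metric \<Rightarrow> ('a \<Rightarrow> 'b) \<Rightarrow> bool" where
  "contractive m1 m2 f \<longleftrightarrow> f \<in> mspace m1 \<rightarrow> mspace m2 \<and>
     (\<forall>x\<in>mspace m1. \<forall>y\<in>mspace m1. mdist m2 (f x) (f y) \<le> mdist m1 x y)"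

(* The library's prod_metric is the Euclidean product metric, hence this variant. *)
definition l1_metric :: "'a metric \<Rightarrow> 'b metric \<Rightarrow> ('a \<times> 'b) metric" where
  "l1_metric m1 m2 = metric (mspace m1 \<times> mspace m2,
     \<lambda>(x, y) (x', y'). mdist m1 x x' + mdist m2 y y')"

lemma Metric_space_l1:
  "Metric_space (mspace m1 \<times> mspace m2)
     (\<lambda>(x, y) (x', y'). mdist m1 x x' + mdist m2 y y')"
proof
  fix p q r :: "'a \<times> 'b"
  let ?d = "\<lambda>(x, y) (x', y'). mdist m1 x x' + mdist m2 y y'"
  show "0 \<le> ?d p q" by (simp add: case_prod_beta)
  show "?d p q = ?d q p" by (simp add: case_prod_beta mdist_commute)
  assume p: "p \<in> mspace m1 \<times> mspace m2" and q: "q \<in> mspace m1 \<times> mspace m2"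
  show "?d p q = 0 \<longleftrightarrow> p = q"
    using p q by (auto simp: add_nonneg_eq_0_iff)
  assume r: "r \<in> mspace m1 \<times> mspace m2"
  have "mdist m1 (fst p) (fst r) \<le> mdist m1 (fst p) (fst q) + mdist m1 (fst q) (fst r)"
    "mdist m2 (snd p) (snd r) \<le> mdist m2 (snd p) (snd q) + mdist m2 (snd q) (snd r)"
    using p q r by (auto intro: mdist_triangle)
  then show "?d p r \<le> ?d p q + ?d q r" by (simp add: case_prod_beta)
qed

lemma mspace_l1_metric [simp]: "mspace (l1_metric m1 m2) = mspace m1 \<times> mspace m2"
  by (simp add: l1_metric_def Metric_space.mspace_metric[OF Metric_space_l1])

lemma mdist_l1_metric [simp]:
  "mdist (l1_metric m1 m2) = (\<lambda>(x, y) (x', y'). mdist m1 x x' + mdist m2 y y')"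
  by (simp add: l1_metric_def Metric_space.mdist_metric[OF Metric_space_l1])


section \<open>Structures and homomorphisms\<close>

record 'a struct =
  uni :: "'a metric"
  zero_of :: 'a
  one_of :: 'a
  plus_of :: "'a \<Rightarrow> 'a \<Rightarrow> 'a"

(* The second and third conjuncts say that the diameter is 1: the supremum on its own
   would be a junk value if the distances were unbounded. *)
definition L_structure :: "'a struct \<Rightarrow> bool" where
  "L_structure M \<longleftrightarrow>
     mcomplete_of (uni M) \<and>
     (\<forall>x\<in>mspace (uni M). \<forall>y\<in>mspace (uni M). mdist (uni M) x y \<le> 1) \<and>
     (SUP (x, y)\<in>mspace (uni M) \<times> mspace (uni M). mdist (uni M) x y) = 1 \<and>
     zero_of M \<in> mspace (uni M) \<and> one_of M \<in> mspace (uni M) \<and>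
     contractive (l1_metric (uni M) (uni M)) (uni M) (\<lambda>(x, y). plus_of M x y)"

definition L_hom :: "'a struct \<Rightarrow> 'b struct \<Rightarrow> ('a \<Rightarrow> 'b) \<Rightarrow> bool" where
  "L_hom M N \<phi> \<longleftrightarrow>
     \<phi> \<in> mspace (uni M) \<rightarrow> mspace (uni N) \<and>
     \<phi> (zero_of M) = zero_of N \<and> \<phi> (one_of M) = one_of N \<and>
     (\<forall>x\<in>mspace (uni M). \<forall>y\<in>mspace (uni M). \<phi> (plus_of M x y) = plus_of N (\<phi> x) (\<phi> y)) \<and>
     (\<forall>x\<in>mspace (uni M). \<forall>y\<in>mspace (uni M). mdist (uni N) (\<phi> x) (\<phi> y) \<le> mdist (uni M) x y)"

definition restrict_struct :: "'a struct \<Rightarrow> 'a set \<Rightarrow> 'a struct" where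
  "restrict_struct M S = M\<lparr>uni := submetric (uni M) S\<rparr>"


section \<open>Continuous logic\<close>

datatype trm = Var nat | Zero | One | Plus trm trm

(* Real-valued formulas, with only the connectives and the quantifier that occur in T_ML. *)
datatype fm = Dist trm trm | Add fm fm | Monus fm fm | Sup nat fm

fun tval :: "'a struct \<Rightarrow> (nat \<Rightarrow> 'a) \<Rightarrow> trm \<Rightarrow> 'a" where
  "tval M e (Var n) = e n"
| "tval M e Zero = zero_of M"
| "tval M e One = one_of M"
| "tval M e (Plus s t) = plus_of M (tval M e s) (tval M e t)"

fun fval :: "'a struct \<Rightarrow> (nat \<Rightarrow> 'a) \<Rightarrow> fm \<Rightarrow> real" where
  "fval M e (Dist s t) = mdist (uni M) (tval M e s) (tval M e t)"
| "fval M e (Add \<phi> \<psi>) = fval M e \<phi> + fval M e \<psi>"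
| "fval M e (Monus \<phi> \<psi>) = max (fval M e \<phi> - fval M e \<psi>) 0"
| "fval M e (Sup n \<phi>) = (SUP a\<in>mspace (uni M). fval M (e(n := a)) \<phi>)"

(* A theory is a set of conditions "sentence = value". Sentences have no free variables,
   so the choice of the valuation e does not matter. *)
definition is_model :: "'a struct \<Rightarrow> (fm \<times> real) set \<Rightarrow> bool" where
  "is_model M T \<longleftrightarrow> L_structure M \<and>
     (\<forall>(\<phi>, r)\<in>T. \<forall>e. range e \<subseteq> mspace (uni M) \<longrightarrow> fval M e \<phi> = r)"

definition T_ML :: "(fm \<times> real) set" where
  "T_ML = (let x = Var 0; y = Var 1; z = Var 2 in
    {(Dist Zero One, 1),
     (Sup 0 (Add (Dist (Plus x Zero) x) (Dist (Plus x One) One)), 0),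
     (Sup 0 (Dist (Plus x x) x), 0),
     (Sup 0 (Sup 1 (Dist (Plus x y) (Plus y x))), 0),
     (Sup 0 (Sup 1 (Sup 2 (Dist (Plus (Plus x y) z) (Plus x (Plus y z))))), 0),
     (Sup 0 (Sup 1 (Sup 2 (Monus (Dist (Plus x z) (Plus y z)) (Dist x y)))), 0),
     (Sup 0 (Sup 1 (Sup 2
       (Monus (Add (Dist x y) (Dist z Zero))
              (Add (Add (Dist (Plus x y) Zero) (Dist (Plus x z) x)) (Dist (Plus y z) y))))), 0)})"


section \<open>Metric lattices\<close>

locale metric_lattice =
  fixes m :: "'a metric"
    and le :: "'a \<Rightarrow> 'a \<Rightarrow> bool"  (infix "\<preceq>" 50)
    and join :: "'a \<Rightarrow> 'a \<Rightarrow> 'a"  (infixl "\<oplus>" 65)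
    and meet :: "'a \<Rightarrow> 'a \<Rightarrow> 'a"  (infixl "\<odot>" 70)
    and zero :: 'a  ("\<zero>")
    and one :: 'a  ("\<one>")
  assumes refl: "reflp_on (mspace m) (\<preceq>)"
    and trans: "transp_on (mspace m) (\<preceq>)"
    and antisym: "antisymp_on (mspace m) (\<preceq>)"
    and zero_closed: "\<zero> \<in> mspace m"
    and one_closed: "\<one> \<in> mspace m"
    and zero_least: "x \<in> mspace m \<Longrightarrow> \<zero> \<preceq> x"
    and one_greatest: "x \<in> mspace m \<Longrightarrow> x \<preceq> \<one>"
    and join_closed: "\<lbrakk>x \<in> mspace m; y \<in> mspace m\<rbrakk> \<Longrightarrow> x \<oplus> y \<in> mspace m"
    and meet_closed: "\<lbrakk>x \<in> mspace m; y \<in> mspace m\<rbrakk> \<Longrightarrow> x \<odot> y \<in> mspace m"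
    and join_commute: "\<lbrakk>x \<in> mspace m; y \<in> mspace m\<rbrakk> \<Longrightarrow> x \<oplus> y = y \<oplus> x"
    and meet_commute: "\<lbrakk>x \<in> mspace m; y \<in> mspace m\<rbrakk> \<Longrightarrow> x \<odot> y = y \<odot> x"
    and join_assoc: "\<lbrakk>x \<in> mspace m; y \<in> mspace m; z \<in> mspace m\<rbrakk>
          \<Longrightarrow> (x \<oplus> y) \<oplus> z = x \<oplus> (y \<oplus> z)"
    and meet_assoc: "\<lbrakk>x \<in> mspace m; y \<in> mspace m; z \<in> mspace m\<rbrakk>
          \<Longrightarrow> (x \<odot> y) \<odot> z = x \<odot> (y \<odot> z)"
    and join_idem: "x \<in> mspace m \<Longrightarrow> x \<oplus> x = x"
    and meet_idem: "x \<in> mspace m \<Longrightarrow> x \<odot> x = x"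
    and le_iff_join: "\<lbrakk>x \<in> mspace m; y \<in> mspace m\<rbrakk> \<Longrightarrow> x \<preceq> y \<longleftrightarrow> x \<oplus> y = y"
    and le_iff_meet: "\<lbrakk>x \<in> mspace m; y \<in> mspace m\<rbrakk> \<Longrightarrow> x \<preceq> y \<longleftrightarrow> x \<odot> y = x"
    and dist_one_zero: "mdist m \<one> \<zero> = 1"
    and dist_join_le: "\<lbrakk>x \<in> mspace m; y \<in> mspace m; z \<in> mspace m\<rbrakk>
          \<Longrightarrow> mdist m (x \<oplus> z) (y \<oplus> z) \<le> mdist m x y"
    and dist_le: "\<lbrakk>x \<in> mspace m; y \<in> mspace m\<rbrakk>
          \<Longrightarrow> mdist m x y \<le> mdist m (x \<oplus> y) \<zero> - mdist m (x \<odot> y) \<zero>"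

locale complete_metric_lattice = metric_lattice +
  assumes complete: "mcomplete_of m"

(* The meet is not part of the language; it is determined by the order. *)
definition is_complete_metric_lattice :: "'a struct \<Rightarrow> bool" where
  "is_complete_metric_lattice M \<longleftrightarrow>
     (\<exists>meet. complete_metric_lattice (uni M) (\<lambda>x y. plus_of M x y = y) (plus_of M) meet
               (zero_of M) (one_of M))"

end

theory Submission
  imports Defs
begin

text \<open>
  Write \<open>f x = d x 0\<close> and \<open>x \<le> y\<close> for \<open>x + y = y\<close>. The theorem rests on one observation:
  in a model of \<open>T\<^sub>M\<^sub>L\<close>, and likewise in a metric lattice, \<open>x \<le> y\<close> implies
  \<open>d x y = f y - f x\<close>. As \<open>f\<close> takes values in \<open>[0, 1]\<close>, monotone sequences are Cauchy, so they
  converge in a complete structure (\<open>increasing_converges\<close>, \<open>decreasing_converges\<close>).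

  For a model, this produces meets (\<open>greatest_lower_bound_exists\<close>): the common lower bounds of \<open>x\<close>
  and \<open>y\<close> form a topologically closed set that is closed under joins, so \<open>f\<close> attains its
  supremum on it, at the limit of an increasing sequence of joins, and by the observation a point
  where it does so is the greatest element. The last axiom, taken at this greatest element, is the inequality \<open>d x y \<le> f (x + y) - f (x y)\<close>.

  In the other direction only the last axiom needs an argument (\<open>metric_lattice_semilattice\<close>). Going
  from \<open>x\<close> to \<open>y\<close> through \<open>x + y\<close> gives \<open>d x y \<le> 2 f (x + y) - f x - f y\<close>, and contractivity of
  \<open>+\<close> gives the submodular inequality \<open>f (x + y + z) - f (y + z) \<le> f (x + z) - f z\<close>. As
  \<open>f (x + y) \<le> f (x + y + z)\<close>, their sum implies the axiom.

  All axioms except completeness are universal, so a homomorphic image inherits them. Completeness of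
  the image (\<open>hom_image_complete\<close>) is not automatic for a contractive map. Given a rapidly
  converging Cauchy sequence \<open>\<phi> (s n)\<close>, its limit is the image of the limit superior of \<open>s\<close>,
  that is of \<open>lim\<^sub>n lim\<^sub>k (s n + \<dots> + s (n + k))\<close>. The monotone limits exist in the domain
  although \<open>s\<close> itself need not converge, and contractivity of \<open>+\<close> keeps
  \<open>\<phi> (s n) + \<dots> + \<phi> (s (n + k))\<close> close to \<open>\<phi> (s n)\<close>, uniformly in \<open>k\<close>.
\<close>

section \<open>The axioms of \<open>T\<^sub>M\<^sub>L\<close> as properties of a join operation\<close>

locale metric_semilattice =
  fixes m :: "'a metric"
    and join :: "'a \<Rightarrow> 'a \<Rightarrow> 'a"  (infixl "\<oplus>" 65)
    and zero :: 'a  ("\<zero>")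
    and one :: 'a  ("\<one>")
  assumes zero_closed: "\<zero> \<in> mspace m"
    and one_closed: "\<one> \<in> mspace m"
    and join_closed: "\<lbrakk>x \<in> mspace m; y \<in> mspace m\<rbrakk> \<Longrightarrow> x \<oplus> y \<in> mspace m"
    and dist_zero_one: "mdist m \<zero> \<one> = 1"
    and join_zero: "x \<in> mspace m \<Longrightarrow> x \<oplus> \<zero> = x"
    and join_one: "x \<in> mspace m \<Longrightarrow> x \<oplus> \<one> = \<one>"
    and join_idem: "x \<in> mspace m \<Longrightarrow> x \<oplus> x = x"
    and join_commute: "\<lbrakk>x \<in> mspace m; y \<in> mspace m\<rbrakk> \<Longrightarrow> x \<oplus> y = y \<oplus> x"
    and join_assoc: "\<lbrakk>x \<in> mspace m; y \<in> mspace m; z \<in> mspace m\<rbrakk>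
          \<Longrightarrow> (x \<oplus> y) \<oplus> z = x \<oplus> (y \<oplus> z)"
    and dist_join_le: "\<lbrakk>x \<in> mspace m; y \<in> mspace m; z \<in> mspace m\<rbrakk>
          \<Longrightarrow> mdist m (x \<oplus> z) (y \<oplus> z) \<le> mdist m x y"
    and dist_lower_bound: "\<lbrakk>x \<in> mspace m; y \<in> mspace m; z \<in> mspace m\<rbrakk>
          \<Longrightarrow> mdist m x y + mdist m z \<zero>
              \<le> mdist m (x \<oplus> y) \<zero> + mdist m (x \<oplus> z) x + mdist m (y \<oplus> z) y"
begin

lemma dist_join_le_left:
  assumes "x \<in> mspace m" "y \<in> mspace m" "z \<in> mspace m"
  shows "mdist m (z \<oplus> x) (z \<oplus> y) \<le> mdist m x y"
  using dist_join_le[OF assms] assms by (simp add: join_commute)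

text \<open>The last axiom, with the lower bound \<open>x\<close> of \<open>x\<close> and \<open>y\<close> as its third argument, gives one
  inequality; the other one is the triangle inequality.\<close>

lemma dist_of_le:
  assumes x: "x \<in> mspace m" and y: "y \<in> mspace m" and le: "x \<oplus> y = y"
  shows "mdist m x y = mdist m y \<zero> - mdist m x \<zero>"
proof -
  have "x \<oplus> x = x" "y \<oplus> x = y" "mdist m x x = 0" "mdist m y y = 0"
    using x y le by (simp_all add: join_idem join_commute[of y x])
  then have "mdist m x y + mdist m x \<zero> \<le> mdist m y \<zero>"
    using dist_lower_bound[OF x y x] le by simp
  moreover have "mdist m y \<zero> \<le> mdist m y x + mdist m x \<zero>"
    using y x zero_closed by (rule mdist_triangle)
  ultimately show ?thesis by (simp add: mdist_commute)
qed

lemma join_absorb_left: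
  assumes "x \<in> mspace m" "y \<in> mspace m"
  shows "x \<oplus> (x \<oplus> y) = x \<oplus> y"
  using assms by (simp add: join_assoc[symmetric] join_idem)

lemma height_mono:
  assumes "x \<in> mspace m" "y \<in> mspace m"
  shows "mdist m y \<zero> \<le> mdist m (x \<oplus> y) \<zero>"
  using dist_of_le[of y "y \<oplus> x"] assms mdist_nonneg[of m y "y \<oplus> x"]
  by (simp add: join_closed join_absorb_left join_commute[of x y])

lemma height_le_one: "x \<in> mspace m \<Longrightarrow> mdist m x \<zero> \<le> 1"
  using height_mono[of \<one> x] dist_zero_one
  by (simp add: one_closed join_one join_commute[of \<one> x] mdist_commute)


section \<open>Monotone sequences converge\<close>

lemma converges_if_dominated:
  fixes g :: "nat \<Rightarrow> real"
  assumes complete: "mcomplete_of m" and s: "\<And>n. s n \<in> mspace m"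
    and g: "Cauchy g" and dom: "\<And>i j. i \<le> j \<Longrightarrow> mdist m (s i) (s j) \<le> \<bar>g i - g j\<bar>"
  obtains l where "l \<in> mspace m" "(\<lambda>n. mdist m (s n) l) \<longlonglongrightarrow> 0"
proof -
  interpret Metric_space "mspace m" "mdist m" by (rule Metric_space_mspace_mdist)
  have dom': "mdist m (s i) (s j) \<le> \<bar>g i - g j\<bar>" for i j
    using dom[of i j] dom[of j i] by (cases "i \<le> j") (auto simp: mdist_commute abs_minus_commute)
  have "MCauchy s"
    unfolding MCauchy_def
  proof (intro conjI allI impI)
    show "range s \<subseteq> mspace m" using s by auto
    fix \<epsilon> :: real assume "\<epsilon> > 0"
    then obtain K where "\<forall>i\<ge>K. \<forall>j\<ge>K. norm (g i - g j) < \<epsilon>" using CauchyD[OF g] by blast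
    then show "\<exists>K. \<forall>i j. K \<le> i \<longrightarrow> K \<le> j \<longrightarrow> mdist m (s i) (s j) < \<epsilon>"
      using dom' by (metis le_less_trans real_norm_def)
  qed
  then obtain l where "limitin mtopology s l sequentially"
    using complete unfolding mcomplete_of_def mcomplete_def by blast
  then show ?thesis using that by (auto simp: limitin_metric_dist_null)
qed

lemma increasing_converges:
  assumes complete: "mcomplete_of m" and s: "\<And>n. s n \<in> mspace m"
    and inc: "\<And>n. s n \<oplus> s (Suc n) = s (Suc n)"
  obtains l where "l \<in> mspace m" "(\<lambda>n. mdist m (s n) l) \<longlonglongrightarrow> 0"
proof -
  have inc': "s i \<oplus> s j = s j" if "i \<le> j" for i j
    using that
  proof (induction j rule: dec_induct)
    case base
    then show ?case using s by (rule join_idem)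
  next
    case (step j)
    then show ?case using inc[of j] join_assoc[OF s s s, of i j "Suc j"] by simp
  qed
  have "mono (\<lambda>n. mdist m (s n) \<zero>)"
  proof (rule monoI)
    fix i j :: nat assume "i \<le> j"
    then show "mdist m (s i) \<zero> \<le> mdist m (s j) \<zero>"
      using height_mono[OF s s, of i j] inc'[of i j] s by (simp add: join_commute[of "s i"])
  qed
  moreover have "Bseq (\<lambda>n. mdist m (s n) \<zero>)"
    using height_le_one[OF s] by (intro BseqI'[where K = 1]) simp
  ultimately have "Cauchy (\<lambda>n. mdist m (s n) \<zero>)"
    by (intro convergent_Cauchy Bseq_monoseq_convergent) (simp_all add: incseq_imp_monoseq)
  then show ?thesis
  proof (rule converges_if_dominated[of s, OF complete s])
    show "mdist m (s i) (s j) \<le> \<bar>mdist m (s i) \<zero> - mdist m (s j) \<zero>\<bar>" if "i \<le> j" for i j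
      using dist_of_le[OF s s inc'[OF that]] by simp
  qed (rule that)
qed

lemma decreasing_converges:
  assumes complete: "mcomplete_of m" and s: "\<And>n. s n \<in> mspace m"
    and dec: "\<And>n. s (Suc n) \<oplus> s n = s n"
  obtains l where "l \<in> mspace m" "(\<lambda>n. mdist m (s n) l) \<longlonglongrightarrow> 0"
proof -
  have dec': "s j \<oplus> s i = s i" if "i \<le> j" for i j
    using that
  proof (induction j rule: dec_induct)
    case base
    then show ?case using s by (rule join_idem)
  next
    case (step j)
    then show ?case using dec[of j] join_assoc[OF s s s, of "Suc j" j i] by simp
  qed
  have "antimono (\<lambda>n. mdist m (s n) \<zero>)"
  proof (rule antimonoI)
    fix i j :: nat assume "i \<le> j"
    then show "mdist m (s j) \<zero> \<le> mdist m (s i) \<zero>"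
      using height_mono[of "s i" "s j"] dec'[of i j] s by (simp add: join_commute[of "s i"])
  qed
  moreover have "Bseq (\<lambda>n. mdist m (s n) \<zero>)"
    using height_le_one[OF s] by (intro BseqI'[where K = 1]) simp
  ultimately have "Cauchy (\<lambda>n. mdist m (s n) \<zero>)"
    by (intro convergent_Cauchy Bseq_monoseq_convergent) (simp_all add: decseq_imp_monoseq)
  then show ?thesis
  proof (rule converges_if_dominated[of s, OF complete s])
    show "mdist m (s i) (s j) \<le> \<bar>mdist m (s i) \<zero> - mdist m (s j) \<zero>\<bar>" if "i \<le> j" for i j
      using dist_of_le[OF s s dec'[OF that]] by (simp add: mdist_commute[of m "s i"])
  qed (rule that)
qed

lemma limit_unique:
  assumes "l \<in> mspace m" "l' \<in> mspace m" and s: "\<And>n. s n \<in> mspace m"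
    and l: "(\<lambda>n. mdist m (s n) l) \<longlonglongrightarrow> 0" and l': "(\<lambda>n. mdist m (s n) l') \<longlonglongrightarrow> 0"
  shows "l = l'"
proof -
  interpret Metric_space "mspace m" "mdist m" by (rule Metric_space_mspace_mdist)
  have "limitin mtopology s l sequentially" "limitin mtopology s l' sequentially"
    using assms by (simp_all add: limitin_metric_dist_null)
  then show ?thesis using limitin_metric_unique trivial_limit_sequentially by blast
qed

lemma join_limit:
  assumes "x \<in> mspace m" "l \<in> mspace m" and s: "\<And>n. s n \<in> mspace m"
    and l: "(\<lambda>n. mdist m (s n) l) \<longlonglongrightarrow> 0"
  shows "(\<lambda>n. mdist m (x \<oplus> s n) (x \<oplus> l)) \<longlonglongrightarrow> 0"
  by (rule Lim_null_comparison[OF _ l]) (use assms dist_join_le_left in simp)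

text \<open>The join of \<open>s n, \<dots>, s (n + k)\<close>. The recursion splits off the first term and not the last
  one, since the estimates for homomorphic images compare the join with \<open>s n\<close>.\<close>

primrec joins :: "(nat \<Rightarrow> 'a) \<Rightarrow> nat \<Rightarrow> nat \<Rightarrow> 'a" where
  "joins s n 0 = s n"
| "joins s n (Suc k) = s n \<oplus> joins s (Suc n) k"

lemma joins_closed:
  assumes "\<And>n. s n \<in> mspace m"
  shows "joins s n k \<in> mspace m"
  using assms by (induction k arbitrary: n) (auto intro: join_closed)

lemma joins_increasing:
  assumes s: "\<And>n. s n \<in> mspace m"
  shows "joins s n k \<oplus> joins s n (Suc k) = joins s n (Suc k)"
proof (induction k arbitrary: n)
  case 0
  show ?case using s by (simp add: join_absorb_left)
next
  case (Suc k)
  let ?a = "joins s (Suc n) k" and ?b = "joins s (Suc n) (Suc k)"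
  note closed = s[of n] joins_closed[of s "Suc n" k, OF s] joins_closed[of s "Suc n" "Suc k", OF s]
  have "(s n \<oplus> ?a) \<oplus> (s n \<oplus> ?b) = s n \<oplus> (s n \<oplus> (?a \<oplus> ?b))"
    using closed by (metis join_assoc join_closed join_commute)
  also have "\<dots> = s n \<oplus> ?b"
    using closed Suc.IH join_absorb_left by metis
  finally show ?case by simp
qed


section \<open>Meets\<close>

text \<open>A point of maximal height among the common lower bounds is their greatest element: joining it
  with another one stays in the set, cannot increase the height, and so does not move it.\<close>

lemma greatest_lower_bound_exists:
  assumes complete: "mcomplete_of m" and x: "x \<in> mspace m" and y: "y \<in> mspace m"
  obtains z where "z \<in> mspace m" "x \<oplus> z = x" "y \<oplus> z = y"
    "\<And>w. \<lbrakk>w \<in> mspace m; x \<oplus> w = x; y \<oplus> w = y\<rbrakk> \<Longrightarrow> w \<oplus> z = z"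
proof -
  define S where "S = {w \<in> mspace m. x \<oplus> w = x \<and> y \<oplus> w = y}"
  let ?f = "\<lambda>w. mdist m w \<zero>"
  let ?h = "SUP w\<in>S. ?f w"
  have SM: "w \<in> mspace m" if "w \<in> S" for w using that by (simp add: S_def)
  have S_join: "v \<oplus> w \<in> S" if "v \<in> S" "w \<in> S" for v w
    using that x y unfolding S_def by (auto simp: join_closed join_assoc[symmetric])
  have "\<zero> \<in> S" using x y by (simp add: S_def zero_closed join_zero)
  have bdd: "bdd_above (?f ` S)" using SM height_le_one by (intro bdd_aboveI[of _ 1]) auto
  have "\<exists>w\<in>S. ?h - inverse (real (Suc n)) < ?f w" for n
  proof -
    have "?h - inverse (real (Suc n)) < ?h" by simp
    then show ?thesis using less_cSUP_iff[OF _ bdd] \<open>\<zero> \<in> S\<close> by blast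
  qed
  then obtain s where sS: "\<And>n. s n \<in> S"
    and s_sup: "\<And>n. ?h - inverse (real (Suc n)) < ?f (s n)" by metis
  note sM = SM[OF sS]
  note JM = joins_closed[of s, OF sM]
  have JS: "joins s n k \<in> S" for n k
    by (induction k arbitrary: n) (auto intro: sS S_join)
  have J_height: "?f (s (n + k)) \<le> ?f (joins s n k)" for n k
  proof (induction k arbitrary: n)
    case (Suc k)
    then show ?case
      using Suc.IH[of "Suc n"] height_mono[OF sM[of n] JM[of "Suc n" k]] by simp
  qed simp
  obtain z where zM: "z \<in> mspace m" and z: "(\<lambda>k. mdist m (joins s 0 k) z) \<longlonglongrightarrow> 0"
    using increasing_converges[of "joins s 0", OF complete JM joins_increasing[of s, OF sM]] by blast
  have absorb: "u \<oplus> z = u" if u: "u \<in> mspace m" and "\<And>w. w \<in> S \<Longrightarrow> u \<oplus> w = u" for u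
  proof -
    have "(\<lambda>k. mdist m u (u \<oplus> z)) \<longlonglongrightarrow> 0"
      using join_limit[of u z "joins s 0", OF u zM JM z] that(2)[OF JS] by simp
    then show ?thesis using u zM by (simp add: LIMSEQ_const_iff join_closed)
  qed
  have zS: "z \<in> S" using absorb[OF x] absorb[OF y] zM by (simp add: S_def)
  have z_max: "?h \<le> ?f z"
  proof (rule LIMSEQ_le[OF _ _ exI[of _ 0]])
    show "(\<lambda>n. ?h - inverse (real (Suc n)) - mdist m (joins s 0 n) z) \<longlonglongrightarrow> ?h"
      using tendsto_diff[OF tendsto_diff[OF tendsto_const LIMSEQ_inverse_real_of_nat] z] by simp
    show "\<forall>n\<ge>0. ?h - inverse (real (Suc n)) - mdist m (joins s 0 n) z \<le> ?f z"
    proof (intro allI impI)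
      fix n :: nat
      show "?h - inverse (real (Suc n)) - mdist m (joins s 0 n) z \<le> ?f z"
        using s_sup[of n] J_height[of 0 n] mdist_triangle[OF JM zM zero_closed, of 0 n] by simp
    qed
  qed simp
  show ?thesis
  proof (rule that[OF zM])
    show "x \<oplus> z = x" "y \<oplus> z = y" using zS by (simp_all add: S_def)
    fix w assume w: "w \<in> mspace m" and "x \<oplus> w = x" "y \<oplus> w = y"
    then have wS: "w \<in> S" by (simp add: S_def)
    have "z \<oplus> w \<in> S" using wS zS by (rule S_join[rotated])
    then have "?f (z \<oplus> w) \<le> ?f z" using cSUP_upper[OF _ bdd] z_max by fastforce
    then have "mdist m z (z \<oplus> w) \<le> 0"
      using dist_of_le[of z "z \<oplus> w"] w zM by (simp add: join_closed join_absorb_left)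
    then have "z = z \<oplus> w" using w zM by (simp add: join_closed order_antisym_conv)
    then show "w \<oplus> z = z" using w zM by (simp add: join_commute)
  qed
qed

lemma complete_imp_metric_lattice:
  assumes complete: "mcomplete_of m"
  shows "\<exists>meet. complete_metric_lattice m (\<lambda>x y. x \<oplus> y = y) (\<oplus>) meet \<zero> \<one>"
proof -
  \<comment> \<open>This form of the universal property reduces the laws of the meet to propositional logic.\<close>
  define is_meet where "is_meet x y z \<longleftrightarrow>
    z \<in> mspace m \<and> (\<forall>w\<in>mspace m. w \<oplus> z = z \<longleftrightarrow> w \<oplus> x = x \<and> w \<oplus> y = y)" for x y z
  have le_trans: "x \<oplus> z = z"
    if "x \<in> mspace m" "y \<in> mspace m" "z \<in> mspace m" "x \<oplus> y = y" "y \<oplus> z = z" for x y z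
    using that by (metis join_assoc)
  have unique: "z = z'" if "is_meet x y z" "is_meet x y z'" for x y z z'
    using that unfolding is_meet_def by (metis join_commute join_idem)
  define meet where "meet x y = (THE z. is_meet x y z)" for x y
  have meet: "is_meet x y (meet x y)" if x: "x \<in> mspace m" and y: "y \<in> mspace m" for x y
  proof -
    obtain z where z: "z \<in> mspace m" "x \<oplus> z = x" "y \<oplus> z = y"
      and greatest: "\<And>w. \<lbrakk>w \<in> mspace m; x \<oplus> w = x; y \<oplus> w = y\<rbrakk> \<Longrightarrow> w \<oplus> z = z"
      using greatest_lower_bound_exists[OF complete x y] by metis
    have "z \<oplus> x = x" "z \<oplus> y = y" using z x y by (simp_all add: join_commute)
    then have "is_meet x y z"
      using x y z(1) le_trans greatest unfolding is_meet_def by (metis join_commute)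
    then show ?thesis using unique unfolding meet_def by (blast intro: theI)
  qed
  have meet_closed: "meet x y \<in> mspace m" if "x \<in> mspace m" "y \<in> mspace m" for x y
    using meet[OF that] by (simp add: is_meet_def)
  have le_meet: "w \<oplus> meet x y = meet x y \<longleftrightarrow> w \<oplus> x = x \<and> w \<oplus> y = y"
    if "x \<in> mspace m" "y \<in> mspace m" "w \<in> mspace m" for w x y
    using meet[OF that(1,2)] that(3) by (simp add: is_meet_def)
  have meet_le: "meet x y \<oplus> x = x" "meet x y \<oplus> y = y" if "x \<in> mspace m" "y \<in> mspace m" for x y
    using le_meet[OF that meet_closed[OF that]] that by (simp_all add: meet_closed join_idem)
  have meetI: "meet x y = z" if "x \<in> mspace m" "y \<in> mspace m" "is_meet x y z" for x y z
    using meet[OF that(1,2)] that(3) by (rule unique)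
  have "complete_metric_lattice m (\<lambda>x y. x \<oplus> y = y) (\<oplus>) meet \<zero> \<one>"
  proof
    fix x y z assume "x \<in> mspace m" "y \<in> mspace m" "z \<in> mspace m"
    then show "meet (meet x y) z = meet x (meet y z)"
      by (intro meetI) (auto simp: is_meet_def meet_closed le_meet)
  next
    fix x y assume xy: "x \<in> mspace m" "y \<in> mspace m"
    show "meet x y = meet y x"
      using xy by (intro meetI) (auto simp: is_meet_def meet_closed le_meet)
    show "x \<oplus> y = y \<longleftrightarrow> meet x y = x"
    proof
      assume "x \<oplus> y = y"
      then have "is_meet x y x"
        using xy le_trans[of _ x y] by (auto simp: is_meet_def)
      then show "meet x y = x" using xy by (intro meetI)
    next
      assume "meet x y = x"
      then show "x \<oplus> y = y" using meet_le(2)[OF xy] by simp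
    qed
    show "mdist m x y \<le> mdist m (x \<oplus> y) \<zero> - mdist m (meet x y) \<zero>"
    proof -
      have "x \<oplus> meet x y = x" "y \<oplus> meet x y = y" "mdist m x x = 0" "mdist m y y = 0"
        using meet_le[OF xy] xy by (simp_all add: join_commute[of _ "meet x y"] meet_closed)
      then show ?thesis using dist_lower_bound[OF xy meet_closed[OF xy]] by simp
    qed
    show "meet x y \<in> mspace m" using xy by (rule meet_closed)
  next
    fix x assume x: "x \<in> mspace m"
    then show "meet x x = x" by (intro meetI) (auto simp: is_meet_def)
    show "\<zero> \<oplus> x = x" using x by (simp add: join_commute[of \<zero>] zero_closed join_zero)
  next
    show "reflp_on (mspace m) (\<lambda>x y. x \<oplus> y = y)" by (simp add: reflp_on_def join_idem)
    show "transp_on (mspace m) (\<lambda>x y. x \<oplus> y = y)" unfolding transp_on_def using le_trans by blast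
    show "antisymp_on (mspace m) (\<lambda>x y. x \<oplus> y = y)"
      unfolding antisymp_on_def using join_commute by metis
    show "mdist m \<one> \<zero> = 1" using dist_zero_one by (simp add: mdist_commute)
  qed (rule refl zero_closed one_closed join_one join_closed join_commute join_assoc join_idem
      dist_join_le complete; assumption)+
  then show ?thesis by (rule exI[of _ meet])
qed

end

text \<open>Only the last axiom is not immediate. The obvious bound \<open>d x y \<le> f (x + y) - f (x y)\<close> does not
  lead to it directly, because it leaves \<open>f z - f (x y)\<close> to be estimated by
  \<open>d (x + z) x + d (y + z) y\<close>. The path from \<open>x\<close> to \<open>y\<close> through \<open>x + y\<close> leaves a difference of
  heights of joins, to which contractivity of the join applies.\<close>

lemma (in metric_lattice) metric_lattice_semilattice: "metric_semilattice m (\<oplus>) \<zero> \<one>"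
proof
  let ?f = "\<lambda>x. mdist m x \<zero>"
  have dist_of_le: "mdist m x y = ?f y - ?f x"
    if x: "x \<in> mspace m" and y: "y \<in> mspace m" and le: "x \<oplus> y = y" for x y
    using dist_le[OF x y] mdist_triangle[OF y x zero_closed] le_iff_join[OF x y] le_iff_meet[OF x y] le
    by (simp add: mdist_commute)
  have join_upper: "x \<oplus> (x \<oplus> y) = x \<oplus> y" if "x \<in> mspace m" "y \<in> mspace m" for x y
    using that by (simp add: join_assoc[symmetric] join_idem)
  have dist_join: "mdist m (x \<oplus> y) x = ?f (x \<oplus> y) - ?f x" if "x \<in> mspace m" "y \<in> mspace m" for x y
    using that dist_of_le[of x "x \<oplus> y"] by (simp add: join_closed join_upper mdist_commute)
  fix x y z assume x: "x \<in> mspace m" and y: "y \<in> mspace m" and z: "z \<in> mspace m"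
  have path: "mdist m x y \<le> (?f (x \<oplus> y) - ?f x) + (?f (x \<oplus> y) - ?f y)"
    using mdist_triangle[OF x join_closed[OF x y] y] dist_join[OF x y] dist_join[OF y x]
    by (simp add: mdist_commute join_commute[OF x y])
  have "?f (x \<oplus> y) \<le> ?f ((x \<oplus> y) \<oplus> z)"
    using dist_join[OF join_closed[OF x y] z] mdist_nonneg[of m "(x \<oplus> y) \<oplus> z" "x \<oplus> y"] by simp
  moreover have "?f ((x \<oplus> y) \<oplus> z) - ?f (y \<oplus> z) \<le> ?f (x \<oplus> z) - ?f z"
  proof -
    have "mdist m ((z \<oplus> x) \<oplus> y) (z \<oplus> y) \<le> mdist m (z \<oplus> x) z"
      using x y z by (intro dist_join_le join_closed)
    moreover have "(z \<oplus> x) \<oplus> y = (x \<oplus> y) \<oplus> z" "(z \<oplus> y) \<oplus> x = (x \<oplus> y) \<oplus> z"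
      using join_assoc[OF z x y] join_assoc[OF z y x] join_commute[OF join_closed[OF x y] z]
        join_commute[OF x y] by simp_all
    ultimately show ?thesis
      using dist_join[OF z x] dist_join[OF join_closed[OF z y] x]
        join_commute[OF x z] join_commute[OF y z] by simp
  qed
  ultimately show "mdist m x y + ?f z \<le> ?f (x \<oplus> y) + mdist m (x \<oplus> z) x + mdist m (y \<oplus> z) y"
    using path dist_join[OF x z] dist_join[OF y z] by simp
next
  fix x assume x: "x \<in> mspace m"
  show "x \<oplus> \<zero> = x"
    using x zero_least[OF x] le_iff_join[OF zero_closed x] by (simp add: join_commute zero_closed)
  show "x \<oplus> \<one> = \<one>" using one_greatest[OF x] le_iff_join[OF x one_closed] by simp
next
  show "mdist m \<zero> \<one> = 1" using dist_one_zero by (simp add: mdist_commute)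
qed (fact zero_closed one_closed join_closed join_idem join_commute join_assoc dist_join_le)+


section \<open>Homomorphic images\<close>

lemma hom_image_semilattice:
  assumes "metric_semilattice m join zero one" "metric_semilattice n join' zero' one'"
    and closed: "\<phi> \<in> mspace m \<rightarrow> mspace n" and "\<phi> zero = zero'" "\<phi> one = one'"
    and hom: "\<And>x y. \<lbrakk>x \<in> mspace m; y \<in> mspace m\<rbrakk> \<Longrightarrow> \<phi> (join x y) = join' (\<phi> x) (\<phi> y)"
  shows "metric_semilattice (submetric n (\<phi> ` mspace m)) join' zero' one'"
proof -
  interpret M: metric_semilattice m join zero one by fact
  interpret N: metric_semilattice n join' zero' one' by fact
  have space: "mspace (submetric n (\<phi> ` mspace m)) = \<phi> ` mspace m" using closed by auto
  have sub: "x \<in> mspace n" if "x \<in> \<phi> ` mspace m" for x using that closed by auto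
  show ?thesis
  proof (unfold_locales, unfold space mdist_submetric)
    fix x y assume "x \<in> \<phi> ` mspace m" "y \<in> \<phi> ` mspace m"
    then show "join' x y \<in> \<phi> ` mspace m" using hom M.join_closed by (auto simp flip: hom)
  next
    show "zero' \<in> \<phi> ` mspace m" "one' \<in> \<phi> ` mspace m"
      using assms(4,5) M.zero_closed M.one_closed by auto
  qed (simp_all add: sub N.dist_zero_one N.join_zero N.join_one N.join_idem
      N.join_commute N.join_assoc N.dist_join_le N.dist_lower_bound)
qed

text \<open>The preimages \<open>s n\<close> of a Cauchy sequence can be far apart, so the limit has to be lifted by order
  theory: it is the image of the limit superior of the \<open>s n\<close>. Passing to a subsequence with summable
  distances is what keeps the images of the joins \<open>s n + \<dots> + s (n + k)\<close> near \<open>\<phi> (s n)\<close>.\<close>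

lemma hom_image_complete:
  assumes "metric_semilattice m join zero one" "metric_semilattice n join' zero' one'"
    and complete: "mcomplete_of m" and closed: "\<phi> \<in> mspace m \<rightarrow> mspace n"
    and hom: "\<And>x y. \<lbrakk>x \<in> mspace m; y \<in> mspace m\<rbrakk> \<Longrightarrow> \<phi> (join x y) = join' (\<phi> x) (\<phi> y)"
    and contr: "\<And>x y. \<lbrakk>x \<in> mspace m; y \<in> mspace m\<rbrakk> \<Longrightarrow> mdist n (\<phi> x) (\<phi> y) \<le> mdist m x y"
  shows "mcomplete_of (submetric n (\<phi> ` mspace m))"
proof -
  interpret M: metric_semilattice m join zero one by fact
  interpret N: metric_semilattice n join' zero' one' by fact
  have space: "mspace (submetric n (\<phi> ` mspace m)) = \<phi> ` mspace m" using closed by auto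
  interpret I: Metric_space "\<phi> ` mspace m" "mdist n"
    using Metric_space_mspace_mdist[of "submetric n (\<phi> ` mspace m)"]
    unfolding space mdist_submetric .
  have \<phi>: "\<phi> x \<in> mspace n" if "x \<in> mspace m" for x using closed that by auto
  have "\<exists>l. limitin I.mtopology y l sequentially" if y: "I.MCauchy y" for y
  proof -
    have yI: "y n \<in> \<phi> ` mspace m" for n using y by (auto simp: I.MCauchy_def)
    \<comment> \<open>Successive distances below \<open>(1/2)^n\<close> sum to the tail bound \<open>2 (1/2)^n\<close> below.\<close>
    have "\<exists>K. \<forall>i j. K \<le> i \<longrightarrow> K \<le> j \<longrightarrow> mdist n (y i) (y j) < (1/2) ^ k" for k
      using y unfolding I.MCauchy_def by simp
    then obtain K where K: "\<And>k i j. \<lbrakk>K k \<le> i; K k \<le> j\<rbrakk> \<Longrightarrow> mdist n (y i) (y j) < (1/2) ^ k"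
      by metis
    define r where "r = rec_nat (K 0) (\<lambda>k i. max (Suc i) (K (Suc k)))"
    have r_Suc: "r (Suc k) = max (Suc (r k)) (K (Suc k))" for k by (simp add: r_def)
    have r_0: "r 0 = K 0" by (simp add: r_def)
    have r_mono: "strict_mono r" unfolding strict_mono_Suc_iff r_Suc by (simp add: less_max_iff_disj)
    have rK: "K k \<le> r k" for k by (cases k) (simp_all add: r_Suc r_0)
    obtain s where s: "\<And>n. s n \<in> mspace m" and ys: "\<And>n. y (r n) = \<phi> (s n)"
    proof -
      have "\<forall>n. \<exists>x. x \<in> mspace m \<and> y (r n) = \<phi> x" using yI by blast
      then show ?thesis using that by metis
    qed
    have fast: "mdist n (\<phi> (s k)) (\<phi> (s (Suc k))) \<le> (1/2) ^ k" for k
    proof -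
      have "K k \<le> r (Suc k)" using rK[of k] by (simp add: r_Suc)
      then show ?thesis using K[OF rK, of k "r (Suc k)"] ys by (simp add: less_imp_le)
    qed
    note JM = M.joins_closed[of s, OF s]
    have near: "mdist n (\<phi> (M.joins s i k)) (\<phi> (s i)) \<le> 2 * (1/2) ^ i" for i k
    proof (induction k arbitrary: i)
      case (Suc k)
      let ?a = "\<phi> (s i)" and ?b = "\<phi> (s (Suc i))" and ?j = "\<phi> (M.joins s (Suc i) k)"
      have in_n: "?a \<in> mspace n" "?b \<in> mspace n" "?j \<in> mspace n" using \<phi> s JM by blast+
      have "mdist n (\<phi> (M.joins s i (Suc k))) ?a = mdist n (join' ?a ?j) (join' ?a ?a)"
        using s JM in_n by (simp add: hom N.join_idem)
      also have "\<dots> \<le> mdist n ?j ?a" using in_n by (intro N.dist_join_le_left)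
      also have "\<dots> \<le> mdist n ?j ?b + mdist n ?b ?a" using in_n by (intro mdist_triangle)
      also have "\<dots> \<le> 2 * (1/2) ^ Suc i + (1/2) ^ i"
        using Suc.IH[of "Suc i"] fast[of i] by (intro add_mono) (simp_all add: mdist_commute)
      finally show ?case by simp
    qed (use \<phi> s in simp)
    have "\<exists>z\<in>mspace m. (\<lambda>k. mdist m (M.joins s i k) z) \<longlonglongrightarrow> 0" for i
      using M.increasing_converges[of "M.joins s i", OF complete JM M.joins_increasing[of s, OF s]]
      by blast
    then obtain z where z: "\<And>i. z i \<in> mspace m"
      and z_lim: "\<And>i. (\<lambda>k. mdist m (M.joins s i k) (z i)) \<longlonglongrightarrow> 0" by metis
    have z_rec: "z i = join (s i) (z (Suc i))" for i
    proof (rule M.limit_unique[of _ _ "\<lambda>k. M.joins s i (Suc k)"])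
      show "(\<lambda>k. mdist m (M.joins s i (Suc k)) (z i)) \<longlonglongrightarrow> 0" using z_lim by (rule LIMSEQ_Suc)
      show "(\<lambda>k. mdist m (M.joins s i (Suc k)) (join (s i) (z (Suc i)))) \<longlonglongrightarrow> 0"
        using M.join_limit[of _ _ "M.joins s (Suc i)", OF s z JM z_lim] by simp
    qed (use s z JM M.join_closed in auto)
    \<comment> \<open>The suprema \<open>z i\<close> of the tails decrease, which makes them converge.\<close>
    have "join (z (Suc i)) (z i) = z i" for i
      using z_rec[of i] s z by (metis M.join_absorb_left M.join_commute)
    then obtain l where l: "l \<in> mspace m" and l_lim: "(\<lambda>i. mdist m (z i) l) \<longlonglongrightarrow> 0"
      using M.decreasing_converges[of z, OF complete z] by blast
    have \<phi>z: "mdist n (\<phi> (s i)) (\<phi> (z i)) \<le> 2 * (1/2) ^ i" for i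
    proof (rule LIMSEQ_le_const[OF _ exI[of _ 0]])
      show "(\<lambda>k. 2 * (1/2) ^ i + mdist m (M.joins s i k) (z i)) \<longlonglongrightarrow> 2 * (1/2) ^ i"
        using tendsto_add[OF tendsto_const z_lim] by simp
      show "\<forall>k\<ge>0. mdist n (\<phi> (s i)) (\<phi> (z i)) \<le> 2 * (1/2) ^ i + mdist m (M.joins s i k) (z i)"
      proof (intro allI impI)
        fix k :: nat
        show "mdist n (\<phi> (s i)) (\<phi> (z i)) \<le> 2 * (1/2) ^ i + mdist m (M.joins s i k) (z i)"
          using mdist_triangle[OF \<phi>[OF s[of i]] \<phi>[OF JM[of i k]] \<phi>[OF z[of i]]] near[of i k]
            contr[OF JM[of i k] z[of i]] by (simp add: mdist_commute)
      qed
    qed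
    have "(\<lambda>i. mdist n (y (r i)) (\<phi> l)) \<longlonglongrightarrow> 0"
    proof (rule Lim_null_comparison)
      show "\<forall>\<^sub>F i in sequentially. norm (mdist n (y (r i)) (\<phi> l)) \<le> 2 * (1/2) ^ i + mdist m (z i) l"
      proof (rule always_eventually, rule allI)
        fix i
        show "norm (mdist n (y (r i)) (\<phi> l)) \<le> 2 * (1/2) ^ i + mdist m (z i) l"
          using mdist_triangle[OF \<phi>[OF s] \<phi>[OF z] \<phi>[OF l], of i i] \<phi>z[of i] contr[OF z l, of i]
          by (simp add: ys)
      qed
      have "(\<lambda>i. (1/2 :: real) ^ i) \<longlonglongrightarrow> 0" by (rule LIMSEQ_power_zero) simp
      then show "(\<lambda>i. 2 * (1/2) ^ i + mdist m (z i) l) \<longlonglongrightarrow> 0"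
        using tendsto_add[OF tendsto_mult_right_zero l_lim] by simp
    qed
    then have "limitin I.mtopology (y \<circ> r) (\<phi> l) sequentially"
      using l yI by (auto simp: I.limitin_metric_dist_null)
    then show ?thesis using I.MCauchy_convergent_subsequence[OF y r_mono] by blast
  qed
  then show ?thesis unfolding mcomplete_of_def space mdist_submetric I.mcomplete_def by blast
qed


section \<open>Evaluating the theory\<close>

lemma plus_of_closed:
  assumes "L_structure M" "x \<in> mspace (uni M)" "y \<in> mspace (uni M)"
  shows "plus_of M x y \<in> mspace (uni M)"
proof -
  have "(\<lambda>(x, y). plus_of M x y) \<in> mspace (uni M) \<times> mspace (uni M) \<rightarrow> mspace (uni M)"
    using assms(1) by (simp add: L_structure_def contractive_def)
  from funcset_mem[OF this, of "(x, y)"] show ?thesis using assms(2,3) by simp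
qed

lemma tval_closed:
  assumes "L_structure M" "range e \<subseteq> mspace (uni M)"
  shows "tval M e t \<in> mspace (uni M)"
  using assms by (induction t) (auto simp: plus_of_closed L_structure_def)

lemma range_fun_upd_subset:
  "\<lbrakk>range e \<subseteq> A; a \<in> A\<rbrakk> \<Longrightarrow> range (e(n := a)) \<subseteq> A"
  by auto

text \<open>An upper bound that is uniform in the valuation makes every supremum in the semantics a genuine
  one.\<close>

lemma fval_bounded:
  assumes M: "L_structure M"
  shows "\<exists>B. \<forall>e. range e \<subseteq> mspace (uni M) \<longrightarrow> 0 \<le> fval M e \<phi> \<and> fval M e \<phi> \<le> B"
proof (induction \<phi>)
  case (Dist s t)
  show ?case using M tval_closed[OF M] by (intro exI[of _ 1]) (simp add: L_structure_def)
next
  case (Add \<phi> \<psi>)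
  then obtain B C where "\<forall>e. range e \<subseteq> mspace (uni M) \<longrightarrow> 0 \<le> fval M e \<phi> \<and> fval M e \<phi> \<le> B"
    "\<forall>e. range e \<subseteq> mspace (uni M) \<longrightarrow> 0 \<le> fval M e \<psi> \<and> fval M e \<psi> \<le> C" by blast
  then show ?case by (intro exI[of _ "B + C"]) (simp add: add_mono)
next
  case (Monus \<phi> \<psi>)
  then obtain B where B: "\<And>e. range e \<subseteq> mspace (uni M) \<Longrightarrow> 0 \<le> fval M e \<phi> \<and> fval M e \<phi> \<le> B"
    and \<psi>: "\<And>e. range e \<subseteq> mspace (uni M) \<Longrightarrow> 0 \<le> fval M e \<psi>" by blast
  show ?case
  proof (intro exI[of _ B] allI impI)
    fix e :: "nat \<Rightarrow> 'a" assume e: "range e \<subseteq> mspace (uni M)"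
    show "0 \<le> fval M e (Monus \<phi> \<psi>) \<and> fval M e (Monus \<phi> \<psi>) \<le> B"
      using B[OF e] \<psi>[OF e] by simp
  qed
next
  case (Sup n \<phi>)
  then obtain B where B:
    "\<And>e. range e \<subseteq> mspace (uni M) \<Longrightarrow> 0 \<le> fval M e \<phi> \<and> fval M e \<phi> \<le> B" by blast
  have z: "zero_of M \<in> mspace (uni M)" using M by (simp add: L_structure_def)
  show ?case
  proof (intro exI[of _ B] allI impI)
    fix e :: "nat \<Rightarrow> 'a" assume e: "range e \<subseteq> mspace (uni M)"
    note B' = B[OF range_fun_upd_subset[OF e]]
    have "bdd_above ((\<lambda>a. fval M (e(n := a)) \<phi>) ` mspace (uni M))"
      using B' by (intro bdd_aboveI[of _ B]) auto
    then have "fval M (e(n := zero_of M)) \<phi> \<le> fval M e (Sup n \<phi>)"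
      unfolding fval.simps by (rule cSUP_upper[OF z])
    then have "0 \<le> fval M e (Sup n \<phi>)" using B'[OF z, of n] by linarith
    moreover have "fval M e (Sup n \<phi>) \<le> B"
      unfolding fval.simps using z B' by (intro cSUP_least) blast+
    ultimately show "0 \<le> fval M e (Sup n \<phi>) \<and> fval M e (Sup n \<phi>) \<le> B" ..
  qed
qed

lemma fval_Sup_eq_0_iff:
  assumes M: "L_structure M" and e: "range e \<subseteq> mspace (uni M)"
  shows "fval M e (Sup n \<phi>) = 0 \<longleftrightarrow> (\<forall>a\<in>mspace (uni M). fval M (e(n := a)) \<phi> = 0)"
proof
  obtain B where B: "\<And>e. range e \<subseteq> mspace (uni M) \<Longrightarrow> 0 \<le> fval M e \<phi> \<and> fval M e \<phi> \<le> B"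
    using fval_bounded[OF M] by blast
  note B' = B[OF range_fun_upd_subset[OF e]]
  have "bdd_above ((\<lambda>a. fval M (e(n := a)) \<phi>) ` mspace (uni M))"
    using B' by (intro bdd_aboveI[of _ B]) auto
  then have upper: "fval M (e(n := a)) \<phi> \<le> fval M e (Sup n \<phi>)"
    if "a \<in> mspace (uni M)" for a
    unfolding fval.simps by (rule cSUP_upper[OF that])
  assume "fval M e (Sup n \<phi>) = 0"
  then show "\<forall>a\<in>mspace (uni M). fval M (e(n := a)) \<phi> = 0" using upper B' by (metis order_antisym)
next
  assume "\<forall>a\<in>mspace (uni M). fval M (e(n := a)) \<phi> = 0"
  moreover have "mspace (uni M) \<noteq> {}" using M by (auto simp: L_structure_def)
  ultimately show "fval M e (Sup n \<phi>) = 0" by simp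
qed

lemma is_model_iff_semilattice:
  assumes M: "L_structure M"
  shows "is_model M T_ML \<longleftrightarrow>
    metric_semilattice (uni M) (plus_of M) (zero_of M) (one_of M)"
proof -
  let ?X = "mspace (uni M)"
  have const: "zero_of M \<in> ?X" "one_of M \<in> ?X" using M by (auto simp: L_structure_def)
  note closed = plus_of_closed[OF M]
  let ?d = "mdist (uni M)" and ?p = "plus_of M" and ?z = "zero_of M" and ?o = "one_of M"
  have eval: "(\<forall>(\<phi>, r)\<in>T_ML. fval M e \<phi> = r) \<longleftrightarrow>
      ?d ?z ?o = 1 \<and>
      (\<forall>x\<in>?X. ?d (?p x ?z) x + ?d (?p x ?o) ?o = 0) \<and>
      (\<forall>x\<in>?X. ?d (?p x x) x = 0) \<and>
      (\<forall>x\<in>?X. \<forall>y\<in>?X. ?d (?p x y) (?p y x) = 0) \<and>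
      (\<forall>x\<in>?X. \<forall>y\<in>?X. \<forall>z\<in>?X. ?d (?p (?p x y) z) (?p x (?p y z)) = 0) \<and>
      (\<forall>x\<in>?X. \<forall>y\<in>?X. \<forall>z\<in>?X. max (?d (?p x z) (?p y z) - ?d x y) 0 = 0) \<and>
      (\<forall>x\<in>?X. \<forall>y\<in>?X. \<forall>z\<in>?X.
        max ((?d x y + ?d z ?z) - (?d (?p x y) ?z + ?d (?p x z) x + ?d (?p y z) y)) 0 = 0)"
    if e: "range e \<subseteq> ?X" for e
  proof -
    note sup_iff = fval_Sup_eq_0_iff[OF M]
    note upd = range_fun_upd_subset
    have S1: "fval M e (Sup i \<phi>) = 0 \<longleftrightarrow> (\<forall>a\<in>?X. fval M (e(i := a)) \<phi> = 0)" for i \<phi>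
      by (rule sup_iff[OF e])
    have S2: "fval M e (Sup i (Sup j \<phi>)) = 0 \<longleftrightarrow>
        (\<forall>a\<in>?X. \<forall>b\<in>?X. fval M (e(i := a, j := b)) \<phi> = 0)" for i j \<phi>
      unfolding S1 by (intro ball_cong refl sup_iff upd e)
    have S3: "fval M e (Sup i (Sup j (Sup k \<phi>))) = 0 \<longleftrightarrow>
        (\<forall>a\<in>?X. \<forall>b\<in>?X. \<forall>c\<in>?X. fval M (e(i := a, j := b, k := c)) \<phi> = 0)" for i j k \<phi>
      unfolding S2 by (intro ball_cong refl sup_iff upd e)
    show ?thesis
      unfolding T_ML_def Let_def ball_simps prod.case
      \<comment> \<open>Longest prefixes first: \<open>S1\<close> also matches the outer quantifier of a longer prefix.\<close>
      unfolding S3 unfolding S2 unfolding S1 by simp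
  qed
  have "is_model M T_ML \<longleftrightarrow> (\<forall>e. range e \<subseteq> ?X \<longrightarrow> (\<forall>(\<phi>, r)\<in>T_ML. fval M e \<phi> = r))"
    unfolding is_model_def case_prod_unfold using M by blast
  also have "\<dots> \<longleftrightarrow> metric_semilattice (uni M) ?p ?z ?o"
    (is "?L \<longleftrightarrow> ?R")
  proof
    assume L: ?L
    have e: "range (\<lambda>_ :: nat. ?z) \<subseteq> ?X" using const by auto
    \<comment> \<open>Sentences do not depend on the valuation, so a single one yields all axioms.\<close>
    note ax = L[THEN spec, THEN mp, OF e]
    note ax = ax[unfolded eval[OF e]]
    note ax1 = ax[THEN conjunct1] and ax = ax[THEN conjunct2]
    note ax2 = ax[THEN conjunct1] and ax = ax[THEN conjunct2]
    note ax3 = ax[THEN conjunct1] and ax = ax[THEN conjunct2]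
    note ax4 = ax[THEN conjunct1] and ax = ax[THEN conjunct2]
    note ax5 = ax[THEN conjunct1] and ax = ax[THEN conjunct2]
    note ax6 = ax[THEN conjunct1] and ax7 = ax[THEN conjunct2]
    show ?R
    proof
      fix x assume x: "x \<in> ?X"
      have "?d (?p x ?z) x + ?d (?p x ?o) ?o = 0" using ax2 x by simp
      then show "?p x ?z = x" "?p x ?o = ?o"
        using x const closed by (simp_all add: add_nonneg_eq_0_iff)
      show "?p x x = x" using ax3 x closed by simp
    next
      fix x y assume "x \<in> ?X" "y \<in> ?X"
      then show "?p x y \<in> ?X" "?p x y = ?p y x" using ax4 closed by simp_all
    next
      fix x y z assume xyz: "x \<in> ?X" "y \<in> ?X" "z \<in> ?X"
      show "?p (?p x y) z = ?p x (?p y z)" using ax5 xyz closed by simp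
      have "max (?d (?p x z) (?p y z) - ?d x y) 0 = 0" using ax6 xyz by blast
      then show "?d (?p x z) (?p y z) \<le> ?d x y" by linarith
      have "max ((?d x y + ?d z ?z) - (?d (?p x y) ?z + ?d (?p x z) x + ?d (?p y z) y)) 0 = 0"
        using ax7 xyz by blast
      then show "?d x y + ?d z ?z \<le> ?d (?p x y) ?z + ?d (?p x z) x + ?d (?p y z) y"
        by linarith
    qed (use ax1 const in simp_all)
  next
    assume R: ?R
    interpret metric_semilattice "uni M" ?p ?z ?o by (fact R)
    have dist_eq_0: "?d x y = 0" if "x = y" "y \<in> ?X" for x y using that by simp
    show ?L
    proof (intro allI impI)
      fix e :: "nat \<Rightarrow> 'a" assume e: "range e \<subseteq> ?X"
      show "\<forall>(\<phi>, r)\<in>T_ML. fval M e \<phi> = r"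
        unfolding eval[OF e] using const
        by (intro conjI ballI) (simp_all add: dist_zero_one dist_eq_0[OF join_zero]
            dist_eq_0[OF join_one] dist_eq_0[OF join_idem] dist_eq_0[OF join_assoc]
            dist_eq_0[OF join_commute] dist_join_le dist_lower_bound closed)
    qed
  qed
  finally show ?thesis .
qed


section \<open>Models and complete metric lattices\<close>

lemma is_complete_metric_lattice_iff_semilattice:
  assumes M: "L_structure M"
  shows "is_complete_metric_lattice M \<longleftrightarrow>
    metric_semilattice (uni M) (plus_of M) (zero_of M) (one_of M)"
proof
  assume "is_complete_metric_lattice M"
  then show "metric_semilattice (uni M) (plus_of M) (zero_of M) (one_of M)"
    unfolding is_complete_metric_lattice_def
    by (blast dest: complete_metric_lattice.axioms(1) metric_lattice.metric_lattice_semilattice)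
next
  assume "metric_semilattice (uni M) (plus_of M) (zero_of M) (one_of M)"
  then show "is_complete_metric_lattice M"
    unfolding is_complete_metric_lattice_def using M
    by (intro metric_semilattice.complete_imp_metric_lattice) (simp_all add: L_structure_def)
qed

lemma L_structure_substructure:
  assumes N: "L_structure N" and S: "S \<subseteq> mspace (uni N)"
    and const: "zero_of N \<in> S" "one_of N \<in> S"
    and plus: "\<And>x y. \<lbrakk>x \<in> S; y \<in> S\<rbrakk> \<Longrightarrow> plus_of N x y \<in> S"
    and dist: "mdist (uni N) (zero_of N) (one_of N) = 1"
    and complete: "mcomplete_of (submetric (uni N) S)"
  shows "L_structure (restrict_struct N S)"
proof -
  have space: "mspace (submetric (uni N) S) = S" using S by auto
  have le: "mdist (uni N) x y \<le> 1" if "x \<in> S" "y \<in> S" for x y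
    using N S that by (auto simp: L_structure_def)
  have "(SUP (x, y)\<in>S \<times> S. mdist (uni N) x y) = 1"
  proof (rule cSup_eq_maximum)
    show "1 \<in> (\<lambda>(x, y). mdist (uni N) x y) ` (S \<times> S)"
      using const dist by (intro image_eqI[of _ _ "(zero_of N, one_of N)"]) auto
  qed (use le in auto)
  then show ?thesis
    using N S const plus complete le space
    by (auto simp: L_structure_def restrict_struct_def contractive_def subset_iff)
qed

theorem proposition5p1:
  fixes M :: "'a struct" and N :: "'b struct"
  assumes "L_structure M" and "L_structure N"
  shows "(is_model M T_ML \<and> is_model N T_ML \<longleftrightarrow>
            is_complete_metric_lattice M \<and> is_complete_metric_lattice N) \<and>
         (is_model M T_ML \<and> is_model N T_ML \<longrightarrow>
            (\<forall>\<phi> :: 'a \<Rightarrow> 'b.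
               (L_hom M N \<phi> \<longleftrightarrow>
                  contractive (uni M) (uni N) \<phi> \<and>
                  \<phi> (zero_of M) = zero_of N \<and> \<phi> (one_of M) = one_of N \<and>
                  (\<forall>x\<in>mspace (uni M). \<forall>y\<in>mspace (uni M).
                     \<phi> (plus_of M x y) = plus_of N (\<phi> x) (\<phi> y))) \<and>
               (L_hom M N \<phi> \<longrightarrow>
                  is_model (restrict_struct N (\<phi> ` mspace (uni M))) T_ML)))"
proof (intro conjI impI allI)
  show "is_model M T_ML \<and> is_model N T_ML \<longleftrightarrow>
      is_complete_metric_lattice M \<and> is_complete_metric_lattice N"
    using assms by (simp add: is_model_iff_semilattice is_complete_metric_lattice_iff_semilattice)
next
  fix \<phi> :: "'a \<Rightarrow> 'b"
  show "L_hom M N \<phi> \<longleftrightarrow>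
      contractive (uni M) (uni N) \<phi> \<and>
      \<phi> (zero_of M) = zero_of N \<and> \<phi> (one_of M) = one_of N \<and>
      (\<forall>x\<in>mspace (uni M). \<forall>y\<in>mspace (uni M). \<phi> (plus_of M x y) = plus_of N (\<phi> x) (\<phi> y))"
    by (auto simp: L_hom_def contractive_def)
next
  fix \<phi> :: "'a \<Rightarrow> 'b"
  assume models: "is_model M T_ML \<and> is_model N T_ML" and "L_hom M N \<phi>"
  then have closed: "\<phi> \<in> mspace (uni M) \<rightarrow> mspace (uni N)"
    and const: "\<phi> (zero_of M) = zero_of N" "\<phi> (one_of M) = one_of N"
    and hom: "\<And>x y. \<lbrakk>x \<in> mspace (uni M); y \<in> mspace (uni M)\<rbrakk>
      \<Longrightarrow> \<phi> (plus_of M x y) = plus_of N (\<phi> x) (\<phi> y)"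
    and contr: "\<And>x y. \<lbrakk>x \<in> mspace (uni M); y \<in> mspace (uni M)\<rbrakk>
      \<Longrightarrow> mdist (uni N) (\<phi> x) (\<phi> y) \<le> mdist (uni M) x y"
    by (auto simp: L_hom_def)
  have M: "metric_semilattice (uni M) (plus_of M) (zero_of M) (one_of M)"
    and N: "metric_semilattice (uni N) (plus_of N) (zero_of N) (one_of N)"
    using models assms by (simp_all add: is_model_iff_semilattice)
  let ?S = "\<phi> ` mspace (uni M)"
  have complete: "mcomplete_of (submetric (uni N) ?S)"
    using assms closed hom contr
    by (intro hom_image_complete[OF M N]) (simp_all add: L_structure_def)
  have semilattice: "metric_semilattice (submetric (uni N) ?S) (plus_of N) (zero_of N) (one_of N)"
    by (rule hom_image_semilattice[where \<phi> = \<phi>, OF M N closed const hom])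
  have sub: "?S \<subseteq> mspace (uni N)" using closed by auto
  then have space: "mspace (submetric (uni N) ?S) = ?S" by auto
  have "L_structure (restrict_struct N ?S)"
    using assms(2) sub
  proof (rule L_structure_substructure)
    show "mdist (uni N) (zero_of N) (one_of N) = 1" using N by (rule metric_semilattice.dist_zero_one)
    show "zero_of N \<in> ?S" "one_of N \<in> ?S"
      using metric_semilattice.zero_closed[OF semilattice]
        metric_semilattice.one_closed[OF semilattice] unfolding space .
    show "plus_of N x y \<in> ?S" if "x \<in> ?S" "y \<in> ?S" for x y
      using metric_semilattice.join_closed[OF semilattice] that unfolding space .
    show "mcomplete_of (submetric (uni N) ?S)" by (rule complete)
  qed
  then show "is_model (restrict_struct N ?S) T_ML"
    using semilattice by (simp add: is_model_iff_semilattice restrict_struct_def)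
qed

end
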